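(* Let $n \ge 2$ and let $m \ge 3$ be an odd integer. Then there is no magic knight's tour in the $n$-dimensional hypercube of order $m$.
   Context: The $n$-dimensional hypercube of order $m$ is the lattice of $m^n$ cells $\{1,\dots,m\}^n$. A knight's move goes from one cell to another cell such that their coordinates differ by exactly $2$ in absolute value in one coordinate, by exactly $1$ in absolute value in another coordinate, and agree in all remaining coordinates. A knight's tour is a sequence of knight's moves that visits every cell exactly once; the cells are numbered $1,2,\dots,m^n$ in the order in which they are visited. A line is a set of $m$ cells obtained by fixing all but one of the coordinates and letting the remaining coordinate run over $1,\dots,m$ (there are $n m^{n-1}$ lines). A knight's tour (open or closed) is magic if the sum of the numbers is the same for every line (space diagonals are not required to have this sum). *)

theory Defs
  imports Main "HOL-Library.FuncSet"
begin

definition cells :: "nat \<Rightarrow> nat \<Rightarrow> (nat \<Rightarrow> nat) set" where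
  "cells n m = {1..n} \<rightarrow>\<^sub>E {1..m}"

definition knight_move :: "nat \<Rightarrow> (nat \<Rightarrow> nat) \<Rightarrow> (nat \<Rightarrow> nat) \<Rightarrow> bool" where
  "knight_move n x y \<longleftrightarrow>
     (\<exists>i\<in>{1..n}. \<exists>j\<in>{1..n}. i \<noteq> j \<and>
        \<bar>int (x i) - int (y i)\<bar> = 2 \<and> \<bar>int (x j) - int (y j)\<bar> = 1 \<and>
        (\<forall>k\<in>{1..n} - {i, j}. x k = y k))"

text \<open>The cell visited at step \<open>k\<close> is \<open>c k\<close>, for \<open>1 \<le> k \<le> m ^ n\<close>; values of \<open>c\<close> outside
  this range are irrelevant. The last cell may or may not be a knight's move away from
  the first, so both open and closed tours (the latter with any starting cell and direction)
  are covered.\<close>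

definition knights_tour :: "nat \<Rightarrow> nat \<Rightarrow> (nat \<Rightarrow> nat \<Rightarrow> nat) \<Rightarrow> bool" where
  "knights_tour n m c \<longleftrightarrow>
     bij_betw c {1..m ^ n} (cells n m) \<and>
     (\<forall>k\<in>{1..<m ^ n}. knight_move n (c k) (c (Suc k)))"

definition cell_number :: "nat \<Rightarrow> nat \<Rightarrow> (nat \<Rightarrow> nat \<Rightarrow> nat) \<Rightarrow> (nat \<Rightarrow> nat) \<Rightarrow> nat" where
  "cell_number n m c = the_inv_into {1..m ^ n} c"

definition lines :: "nat \<Rightarrow> nat \<Rightarrow> (nat \<Rightarrow> nat) set set" where
  "lines n m = {{y \<in> cells n m. \<forall>j\<in>{1..n} - {i}. y j = x j} | i x. i \<in> {1..n} \<and> x \<in> cells n m}"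

definition magic_knights_tour :: "nat \<Rightarrow> nat \<Rightarrow> (nat \<Rightarrow> nat \<Rightarrow> nat) \<Rightarrow> bool" where
  "magic_knights_tour n m c \<longleftrightarrow>
     knights_tour n m c \<and> (\<exists>s. \<forall>L\<in>lines n m. (\<Sum>x\<in>L. cell_number n m c x) = s)"

end

theory Submission
  imports Defs
begin

text \<open>A knight's move changes the parity of the coordinate sum, so along a tour the parity of the
  number of a cell is determined by its colour in the checkerboard colouring. Two adjacent parallel
  lines are matched cell by cell with opposite colours, so the two line sums add up to a sum of
  \<open>m\<close> odd numbers. As \<open>m\<close> is odd, this is odd, hence the two line sums differ.\<close>

lemma knight_move_parity:
  assumes "knight_move n x y"
  shows "even (\<Sum>k\<in>{1..n}. x k) \<longleftrightarrow> odd (\<Sum>k\<in>{1..n}. y k)"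
proof -
  obtain i j where ij: "i \<in> {1..n}" "j \<in> {1..n}" "i \<noteq> j"
    and di: "\<bar>int (x i) - int (y i)\<bar> = 2" and dj: "\<bar>int (x j) - int (y j)\<bar> = 1"
    and rest: "\<forall>k\<in>{1..n} - {i, j}. x k = y k"
    using assms unfolding knight_move_def by blast
  \<comment> \<open>Isolating the two coordinates that change leaves a common remainder; the shift
    by 2 preserves parity and only the shift by 1 flips it.\<close>
  have split: "(\<Sum>k\<in>{1..n}. z k) = z i + z j + (\<Sum>k\<in>{1..n} - {i, j}. z k)" for z :: "nat \<Rightarrow> nat"
    using sum.subset_diff[of "{i, j}" "{1..n}" z] ij by simp
  have "(\<Sum>k\<in>{1..n} - {i, j}. x k) = (\<Sum>k\<in>{1..n} - {i, j}. y k)"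
    using rest by (intro sum.cong) auto
  moreover have "even (x i) \<longleftrightarrow> even (y i)" using di by presburger
  moreover have "even (x j) \<longleftrightarrow> odd (y j)" using dj by presburger
  ultimately show ?thesis
    unfolding split by (metis even_add)
qed

text \<open>Each step flips the parity of both \<open>k\<close> and the coordinate sum, so the
  parity of their total is invariant. The \<open>odd\<close> on the right comes from the value
  \<open>1 + ...\<close> at \<open>k = 1\<close>.\<close>

lemma knights_tour_parity:
  assumes "knights_tour n m c" and "Suc 0 \<le> k" and "k \<le> m ^ n"
  shows "even (k + (\<Sum>i\<in>{1..n}. c k i)) \<longleftrightarrow> odd (\<Sum>i\<in>{1..n}. c 1 i)"
  using assms(2,3)
proof (induction k rule: dec_induct)
  case base
  show ?case by simp
next
  case (step k)
  then have "knight_move n (c k) (c (Suc k))"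
    using assms(1) by (simp add: knights_tour_def)
  then show ?case
    using step knight_move_parity by auto
qed

text \<open>Reads the invariant at the step that visits \<open>x\<close>. The right-hand side does
  not depend on \<open>x\<close>, so two cells can be compared.\<close>

lemma cell_number_parity:
  assumes "knights_tour n m c" and "x \<in> cells n m"
  shows "even (cell_number n m c x + (\<Sum>i\<in>{1..n}. x i)) \<longleftrightarrow> odd (\<Sum>i\<in>{1..n}. c 1 i)"
proof -
  have bij: "bij_betw c {1..m ^ n} (cells n m)"
    using assms(1) by (simp add: knights_tour_def)
  have "cell_number n m c x \<in> {1..m ^ n}"
    using bij_betwE[OF bij_betw_the_inv_into[OF bij]] assms(2) by (simp add: cell_number_def)
  moreover have "c (cell_number n m c x) = x"
    using f_the_inv_into_f_bij_betw[OF bij] assms(2) by (simp add: cell_number_def)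
  ultimately show ?thesis
    using knights_tour_parity[OF assms(1), of "cell_number n m c x"] by simp
qed

lemma cells_fun_upd:
  assumes "x \<in> cells n m" and "i \<in> {1..n}" and "t \<in> {1..m}"
  shows "x(i := t) \<in> cells n m"
  using assms by (auto simp: cells_def PiE_iff extensional_def)

lemma line_eq_image:
  assumes "x \<in> cells n m" and "i \<in> {1..n}"
  shows "{y \<in> cells n m. \<forall>j\<in>{1..n} - {i}. y j = x j} = (\<lambda>t. x(i := t)) ` {1..m}"
proof (intro equalityI subsetI)
  fix y assume y: "y \<in> {y \<in> cells n m. \<forall>j\<in>{1..n} - {i}. y j = x j}"
  then have "y i \<in> {1..m}" using assms(2) by (auto simp: cells_def)
  moreover have "y = x(i := y i)"
  proof
    \<comment> \<open>Outside \<open>{1..n}\<close> both functions are \<open>undefined\<close>,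
      since cells are extensional.\<close>
    fix k show "y k = (x(i := y i)) k"
      using y assms by (cases "k \<in> {1..n}") (auto simp: cells_def PiE_iff extensional_def)
  qed
  ultimately show "y \<in> (\<lambda>t. x(i := t)) ` {1..m}" by blast
qed (use assms cells_fun_upd in \<open>auto split: if_splits\<close>)

text \<open>Indexing a line by its running coordinate \<open>t\<close> allows two parallel lines to
  be added term by term.\<close>

lemma magic_line_sum:
  assumes magic: "\<forall>L\<in>lines n m. (\<Sum>y\<in>L. f y) = s"
    and "x \<in> cells n m" and "i \<in> {1..n}"
  shows "(\<Sum>t\<in>{1..m}. f (x(i := t))) = s"
proof -
  have "(\<lambda>t. x(i := t)) ` {1..m} \<in> lines n m"
    unfolding lines_def using assms line_eq_image[symmetric] by blast
  moreover have "inj_on (\<lambda>t. x(i := t)) {1..m}"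
    by (metis fun_upd_same inj_onI)
  ultimately show ?thesis
    using magic by (auto simp: sum.reindex)
qed

theorem mainTheorem1:
  fixes n m :: nat
  assumes "n \<ge> 2" and "m \<ge> 3" and "odd m"
  shows "\<not> (\<exists>c. magic_knights_tour n m c)"
proof
  assume "\<exists>c. magic_knights_tour n m c"
  then obtain c s where tour: "knights_tour n m c"
    and magic: "\<forall>L\<in>lines n m. (\<Sum>x\<in>L. cell_number n m c x) = s"
    unfolding magic_knights_tour_def by blast
  \<comment> \<open>A corner cell and its neighbour in direction 2; the lines compared run through
    them in direction 1.\<close>
  define x where "x = (\<lambda>k\<in>{1..n}. 1::nat)"
  define x' where "x' = x(2 := 2)"
  let ?f = "cell_number n m c"
  have x: "x \<in> cells n m"
    using assms by (auto simp: x_def cells_def)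
  have x': "x' \<in> cells n m"
    unfolding x'_def using x assms by (intro cells_fun_upd) auto
  have odd_pair: "odd (?f (x(1 := t)) + ?f (x'(1 := t)))" if t: "t \<in> {1..m}" for t
  proof -
    have split: "(\<Sum>k\<in>{1..n}. z k) = z 2 + (\<Sum>k\<in>{1..n} - {2}. z k)" for z :: "nat \<Rightarrow> nat"
      using assms(1) by (intro sum.remove) auto
    have "(\<Sum>k\<in>{1..n} - {2}. (x'(1 := t)) k) = (\<Sum>k\<in>{1..n} - {2}. (x(1 := t)) k)"
      by (intro sum.cong) (auto simp: x'_def)
    then have "(\<Sum>k\<in>{1..n}. (x'(1 := t)) k) = Suc (\<Sum>k\<in>{1..n}. (x(1 := t)) k)"
      unfolding split using assms(1) by (simp add: x'_def x_def)
    moreover have "x(1 := t) \<in> cells n m" "x'(1 := t) \<in> cells n m"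
      using x x' t assms(1) by (auto intro!: cells_fun_upd)
    \<comment> \<open>The coordinate sums differ by one, so by the common invariant the two numbers
      have opposite parity.\<close>
    ultimately show ?thesis
      using cell_number_parity[OF tour] by (metis even_Suc even_add)
  qed
  have "(\<Sum>t\<in>{1..m}. ?f (x(1 := t)) + ?f (x'(1 := t))) = s + s"
    using magic_line_sum[OF magic x, of 1] magic_line_sum[OF magic x', of 1] assms(1)
    by (simp add: sum.distrib)
  \<comment> \<open>The parity of a sum is that of the number of its odd terms, here all
    \<open>m\<close> of them, whereas \<open>s + s\<close> is even.\<close>
  moreover have "{t \<in> {1..m}. odd (?f (x(1 := t)) + ?f (x'(1 := t)))} = {1..m}"
    using odd_pair by blast
  then have "odd (\<Sum>t\<in>{1..m}. ?f (x(1 := t)) + ?f (x'(1 := t)))"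
    using assms(3) even_sum_iff[of "{1..m}" "\<lambda>t. ?f (x(1 := t)) + ?f (x'(1 := t))"] by simp
  ultimately show False by simp
qed

end
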